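(* Let $P$ be an integer with $3\mid P$, and let $\delta\ge 1$ be an integer with $3^{\delta}\,\Vert\, P$ (so $P\neq 0$). Then the following hold. 1) Suppose $k\in\mathbb{N}$, $k\geq 2\delta-1$. Then for every residue $b$ modulo $3^k$, $$v_{u}(3^k,b)=\begin{cases}3^{\lfloor k/2\rfloor}, & \text{if }b\equiv u_{3^{2\lfloor(k-2\delta+1)/4\rfloor+1}}\pmod{3^k},\\ 2\cdot 3^l, &\text{if }b\equiv u_{3^{l-\delta}}\pmod{3^{2l+1}}\text{ for some }l\in\{\delta,\ldots,\lfloor(k-1)/2\rfloor\},\\ 1, &\text{if }b\equiv 0\pmod{3^\delta},\\ 0, &\text{otherwise,}\end{cases}$$ and $$v_{v}(3^k,b)=\begin{cases}3^{\lfloor k/2\rfloor}, & \text{if }b\equiv 2\pmod{3^k},\\ 2\cdot 3^l, &\text{if }b\equiv v_{2\cdot 3^{l-\delta}}\pmod{3^{2l+1}}\text{ for some }l\in\{\delta,\ldots,\lfloor(k-1)/2\rfloor\},\\ 1, &\text{if }b\equiv 0\pmod{3^{\delta}},\\ 0, &\text{otherwise.}\end{cases}$$ 2) Suppose $\delta\geq 2$ and $k\in\mathbb{N}$, $\delta\leq k<2\delta-1$. Then for every residue $b$ modulo $3^k$, $$v_{u}(3^k,b)=\begin{cases}3^{k-\delta}, & \text{if }b\equiv 1\pmod{3^k},\\ 1, &\text{if }b\equiv 0\pmod{3^{\delta}},\\ 0, &\text{otherwise,}\end{cases}$$ and $$v_{v}(3^k,b)=\begin{cases}3^{k-\delta},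 & \text{if }b\equiv 2\pmod{3^k},\\ 1, &\text{if }b\equiv 0\pmod{3^{\delta}},\\ 0, &\text{otherwise.}\end{cases}$$
   Context: For an integer $P$, the sequences $(u_n)$ and $(v_n)$ are defined by $u_0=0$, $u_1=1$, $u_n=Pu_{n-1}+u_{n-2}$ and $v_0=2$, $v_1=P$, $v_n=Pv_{n-1}+v_{n-2}$ for $n\ge 2$. For a prime $p$, $p^k\,\Vert\, n$ means that $p^k$ is the highest power of $p$ dividing $n$. $\mathbb{N}$ is the set of positive integers. For $m\in\mathbb{N}$, $h_u(m)$ (resp. $h_v(m)$) is the length of the shortest period of $(u_n)$ (resp. $(v_n)$) modulo $m$, i.e. the least positive integer $h$ with $u_{n+h}\equiv u_n \pmod m$ (resp. $v_{n+h}\equiv v_n\pmod m$) for all $n\ge 0$. For an integer $b$, the two-argument counting functions (not to be confused with the terms $v_n$) are $v_u(m,b)=\#\{n : 0\le n<h_u(m),\ u_n\equiv b\pmod m\}$ and $v_v(m,b)=\#\{n : 0\le n<h_v(m),\ v_n\equiv b\pmod m\}$. *)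

theory Defs
  imports "HOL-Number_Theory.Number_Theory"
begin

fun lucas_u :: "int \<Rightarrow> nat \<Rightarrow> int" where
  "lucas_u P 0 = 0"
| "lucas_u P (Suc 0) = 1"
| "lucas_u P (Suc (Suc n)) = P * lucas_u P (Suc n) + lucas_u P n"

fun lucas_v :: "int \<Rightarrow> nat \<Rightarrow> int" where
  "lucas_v P 0 = 2"
| "lucas_v P (Suc 0) = P"
| "lucas_v P (Suc (Suc n)) = P * lucas_v P (Suc n) + lucas_v P n"

(* The least element exists for lucas_u P and lucas_v P and every m > 0: the recurrence
   can be run backwards, so both sequences are purely periodic modulo m. *)
definition period_mod :: "(nat \<Rightarrow> int) \<Rightarrow> nat \<Rightarrow> nat" where
  "period_mod s m = (LEAST h. 0 < h \<and> (\<forall>n. [s (n + h) = s n] (mod int m)))"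

definition residue_count :: "(nat \<Rightarrow> int) \<Rightarrow> nat \<Rightarrow> int \<Rightarrow> nat" where
  "residue_count s m b = card {n. n < period_mod s m \<and> [s n = b] (mod int m)}"

end

theory Submission
  imports Defs
begin

text \<open>
  Put \<open>D = P\<^sup>2 + 4\<close>. Modulo \<open>3 ^ k\<close> with \<open>k \<ge> \<delta>\<close> both sequences have period \<open>2 * 3 ^ (k - \<delta>)\<close>, and over one
  period \<open>u n\<close> (\<open>n\<close> even) as well as \<open>v n\<close> (\<open>n\<close> odd) takes every multiple of \<open>3 ^ \<delta>\<close> exactly once.
  This gives the class of \<open>b \<equiv> 0\<close>.
  For the remaining indices use \<open>v (2 n) = (v n)\<^sup>2 + 2\<close> and \<open>D (u n)\<^sup>2 = (v n)\<^sup>2 + 4\<close> for odd \<open>n\<close>: since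
  \<open>2 n\<close> runs through all even indices modulo the period as \<open>n\<close> runs through the odd ones, and since
  \<open>u n \<equiv> 1\<close> modulo 3 is determined by its square, the frequency of \<open>b\<close> is the number of multiples \<open>x\<close>
  of \<open>3 ^ \<delta>\<close> with \<open>x\<^sup>2 \<equiv> b - 2\<close>, respectively \<open>x\<^sup>2 \<equiv> D b\<^sup>2 - 4\<close>, modulo \<open>3 ^ k\<close>. Hensel lifting counts these:
  a nonzero right-hand side must be \<open>3 ^ (2 l)\<close> times a unit congruent to 1 modulo 3.
\<close>

subsection \<open>Identities for Lucas sequences\<close>

lemma lucas_v_eq_u: "lucas_v P n = 2 * lucas_u P (Suc n) - P * lucas_u P n"
  by (induction P n rule: lucas_v.induct) (auto simp: algebra_simps)

text \<open>The factor \<open>lucas_u P (Suc d) - P * lucas_u P d\<close> is the term at index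
  \<open>d - 1\<close>, written through the recurrence so that \<open>d = 0\<close> is
  covered.\<close>

lemma lucas_u_add:
  "lucas_u P (n + d) = lucas_u P n * (lucas_u P (Suc d) - P * lucas_u P d) + lucas_u P (Suc n) * lucas_u P d"
  by (induction P n rule: lucas_u.induct) (auto simp: algebra_simps)

lemma lucas_u_add_Suc:
  "lucas_u P (Suc (n + d)) = lucas_u P n * lucas_u P d + lucas_u P (Suc n) * lucas_u P (Suc d)"
  using lucas_u_add[of P n "Suc d"] by (simp add: algebra_simps)

text \<open>The quadratic form on the left changes sign at every step of the recurrence and equals 1
  at \<open>n = 0\<close>.\<close>

lemma lucas_u_cassini:
  "lucas_u P (Suc n) ^ 2 - P * lucas_u P n * lucas_u P (Suc n) - lucas_u P n ^ 2 = (-1) ^ n"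
proof (induction n)
  case (Suc n)
  have "(-1) ^ Suc n = - ((-1) ^ n :: int)" by simp
  then show ?case unfolding Suc.IH[symmetric] by (simp add: power2_eq_square algebra_simps)
qed simp

text \<open>The roots of x^2 - P x - 1 have product -1. Factoring out the middle index
  \<open>n + d\<close> leaves a sum or a difference of d-th powers of the roots, so the parity of
  \<open>d\<close> decides which sequence supplies each factor.\<close>

lemma lucas_diff:
  fixes P :: int and n d :: nat
  shows lucas_u_diff_even: "even d \<Longrightarrow> lucas_u P (n + 2 * d) - lucas_u P n = lucas_v P (n + d) * lucas_u P d"
    and lucas_u_diff_odd: "odd d \<Longrightarrow> lucas_u P (n + 2 * d) - lucas_u P n = lucas_u P (n + d) * lucas_v P d"
    and lucas_v_diff_even: "even d \<Longrightarrow> lucas_v P (n + 2 * d) - lucas_v P n = (P\<^sup>2 + 4) * lucas_u P (n + d) * lucas_u P d"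
    and lucas_v_diff_odd: "odd d \<Longrightarrow> lucas_v P (n + 2 * d) - lucas_v P n = lucas_v P (n + d) * lucas_v P d"
proof -
  define a b c e where abce: "a = lucas_u P n" "b = lucas_u P (Suc n)" "c = lucas_u P d" "e = lucas_u P (Suc d)"
  define x y where xy: "x = lucas_u P (n + d)" "y = lucas_u P (Suc (n + d))"
  have x: "x = a * (e - P * c) + b * c" and y: "y = a * c + b * e"
    unfolding xy abce by (rule lucas_u_add lucas_u_add_Suc)+
  have u2: "lucas_u P (n + 2 * d) = x * (e - P * c) + y * c"
    and u2s: "lucas_u P (Suc (n + 2 * d)) = x * c + y * e"
    unfolding xy abce using lucas_u_add[of P "n + d" d] lucas_u_add_Suc[of P "n + d" d]
    by (simp_all add: mult_2 add.assoc)
  have cas: "e ^ 2 - P * c * e - c ^ 2 = (-1) ^ d"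
    unfolding abce by (rule lucas_u_cassini)
  \<comment> \<open>Cassini at \<open>d\<close>, multiplied by \<open>a\<close>, \<open>b\<close>
    and \<open>P * a\<close>: after expansion each of the four goals is a linear consequence of
    these.\<close>
  have ab: "a * (e ^ 2 - P * c * e - c ^ 2) = a * (-1) ^ d" "b * (e ^ 2 - P * c * e - c ^ 2) = b * (-1) ^ d"
    "(P * a) * (e ^ 2 - P * c * e - c ^ 2) = (P * a) * (-1) ^ d" unfolding cas by simp_all
  show "lucas_u P (n + 2 * d) - lucas_u P n = lucas_v P (n + d) * lucas_u P d" if "even d"
    unfolding lucas_v_eq_u u2 u2s xy[symmetric] abce[symmetric] x y using ab that
    by (simp add: power2_eq_square algebra_simps)
  show "lucas_u P (n + 2 * d) - lucas_u P n = lucas_u P (n + d) * lucas_v P d" if "odd d"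
    unfolding lucas_v_eq_u u2 u2s xy[symmetric] abce[symmetric] x y using ab that
    by (simp add: power2_eq_square algebra_simps)
  show "lucas_v P (n + 2 * d) - lucas_v P n = (P\<^sup>2 + 4) * lucas_u P (n + d) * lucas_u P d" if "even d"
    unfolding lucas_v_eq_u u2 u2s xy[symmetric] abce[symmetric] x y using ab that
    by (simp add: power2_eq_square algebra_simps)
  show "lucas_v P (n + 2 * d) - lucas_v P n = lucas_v P (n + d) * lucas_v P d" if "odd d"
    unfolding lucas_v_eq_u u2 u2s xy[symmetric] abce[symmetric] x y using ab that
    by (simp add: power2_eq_square algebra_simps)
qed

lemma lucas_v_double_odd: "odd n \<Longrightarrow> lucas_v P (2 * n) = (lucas_v P n)\<^sup>2 + 2"
  using lucas_v_diff_odd[of n P 0] by (simp add: power2_eq_square)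

lemma lucas_v_double_even: "even n \<Longrightarrow> lucas_v P (2 * n) = (P\<^sup>2 + 4) * (lucas_u P n)\<^sup>2 + 2"
  using lucas_v_diff_even[of n P 0] by (simp add: power2_eq_square)

text \<open>Completing the square: four times the Cassini form is \<open>(lucas_v P n)\<^sup>2 -
  (P\<^sup>2 + 4) * (lucas_u P n)\<^sup>2\<close>.\<close>

lemma lucas_u_square_odd: "odd n \<Longrightarrow> (P\<^sup>2 + 4) * (lucas_u P n)\<^sup>2 = (lucas_v P n)\<^sup>2 + 4"
proof -
  assume "odd n"
  then have "lucas_u P (Suc n) ^ 2 - P * lucas_u P n * lucas_u P (Suc n) - lucas_u P n ^ 2 = -1"
    using lucas_u_cassini[of P n] by simp
  then show ?thesis unfolding lucas_v_eq_u by (simp add: power2_eq_square algebra_simps)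
qed

text \<open>If 3 divides the term at \<open>n\<close>, the second factor contains 3 exactly once, so
  tripling the index raises the 3-adic valuation by one. The analogue for \<open>lucas_v\<close> at
  odd indices follows.\<close>

lemma lucas_u_triple_even:
  assumes "even n"
  shows "lucas_u P (3 * n) = lucas_u P n * ((P\<^sup>2 + 4) * (lucas_u P n)\<^sup>2 + 3)"
proof -
  have "lucas_u P (3 * n) - lucas_u P n = lucas_v P (2 * n) * lucas_u P n"
    using lucas_u_diff_even[OF assms, of P n] by (simp flip: mult_2)
  then show ?thesis unfolding lucas_v_double_even[OF assms] by (simp add: algebra_simps)
qed

lemma lucas_v_triple_odd:
  assumes "odd n"
  shows "lucas_v P (3 * n) = lucas_v P n * ((lucas_v P n)\<^sup>2 + 3)"
proof -
  have "lucas_v P (3 * n) - lucas_v P n = lucas_v P (2 * n) * lucas_v P n"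
    using lucas_v_diff_odd[OF assms, of P n] by (simp flip: mult_2)
  then show ?thesis unfolding lucas_v_double_odd[OF assms] by (simp add: algebra_simps)
qed

text \<open>First-order expansion in \<open>P\<close>. The precision \<open>P\<^sup>2\<close> later
  yields the exact power of 3 in these terms at indices prime to 3. For each sequence, the even and
  the odd congruence support each other in the induction.\<close>

lemma lucas_mod_square:
  shows "P\<^sup>2 dvd lucas_u P (2 * n) - int n * P \<and> P dvd lucas_u P (Suc (2 * n)) - 1
    \<and> P dvd lucas_v P (2 * n) - 2 \<and> P\<^sup>2 dvd lucas_v P (Suc (2 * n)) - int (Suc (2 * n)) * P"
proof (induction n)
  case (Suc n)
  then obtain a b c d where
    "lucas_u P (2 * n) = int n * P + P\<^sup>2 * a" "lucas_u P (Suc (2 * n)) = 1 + P * b"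
    "lucas_v P (2 * n) = 2 + P * c" "lucas_v P (Suc (2 * n)) = int (Suc (2 * n)) * P + P\<^sup>2 * d"
    unfolding dvd_def by (metis add_diff_cancel_left' diff_add_cancel add.commute)
  then have "lucas_u P (2 * Suc n) = int (Suc n) * P + P\<^sup>2 * (a + b)"
    "lucas_v P (2 * Suc n) = 2 + P * (c + int (Suc (2 * n)) * P + P\<^sup>2 * d)"
    and "lucas_u P (Suc (2 * Suc n)) = 1 + P * (b + lucas_u P (2 * Suc n))"
    "lucas_v P (Suc (2 * Suc n)) = int (Suc (2 * Suc n)) * P + P\<^sup>2 * (d + c + int (Suc (2 * n)) * P + P\<^sup>2 * d)"
    by (simp_all add: algebra_simps power2_eq_square)
  then show ?case by simp
qed simp

subsection \<open>Counting square roots modulo powers of 3\<close>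

lemma card_residue_class:
  fixes m q r :: int
  assumes "m > 0" "q \<ge> 0"
  shows "card {x \<in> {0..<m * q}. [x = r] (mod m)} = nat q"
proof -
  have "{x \<in> {0..<m * q}. [x = r] (mod m)} = (\<lambda>i. r mod m + m * i) ` {0..<q}" (is "?A = ?B")
  proof
    show "?A \<subseteq> ?B"
    proof
      fix x assume x: "x \<in> ?A"
      then have "x = r mod m + m * (x div m)"
        by (metis (mono_tags, lifting) cong_def mem_Collect_eq mod_mult_div_eq)
      moreover have "x div m \<in> {0..<q}"
      proof -
        have "0 \<le> x" "x < m * q" using x by auto
        moreover have "m * (x div m) \<le> x"
          using mult_div_mod_eq[of m x] pos_mod_sign[OF assms(1), of x] by linarith
        ultimately have "m * (x div m) < m * q" by linarith
        then show ?thesis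
          using assms \<open>0 \<le> x\<close> by (simp add: pos_imp_zdiv_nonneg_iff)
      qed
      ultimately show "x \<in> ?B" by (rule image_eqI)
    qed
    show "?B \<subseteq> ?A"
    proof
      fix x assume "x \<in> ?B"
      then obtain i where i: "0 \<le> i" "i < q" "x = r mod m + m * i"
        unfolding image_iff by (metis atLeastLessThan_iff)
      have "r mod m + m * i < m + m * i" using assms by simp
      also have "\<dots> = m * (i + 1)" by (simp add: algebra_simps)
      also have "\<dots> \<le> m * q" using i assms by (intro mult_left_mono) auto
      finally have "x < m * q" using i by simp
      moreover have "0 \<le> x" using i assms by simp
      moreover have "[x = r] (mod m)" unfolding i cong_def by simp
      ultimately show "x \<in> ?A" by simp
    qed
  qed
  moreover have "inj_on (\<lambda>i. r mod m + m * i) {0..<q}"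
    using assms unfolding inj_on_def by simp
  ultimately show ?thesis by (simp add: card_image)
qed

lemma card_multiples_power:
  fixes p :: int
  assumes "p > 0" "j \<le> k"
  shows "card {x \<in> {0..<p ^ k}. p ^ j dvd x} = nat p ^ (k - j)"
proof -
  have "p ^ k = p ^ j * p ^ (k - j)" using assms by (simp flip: power_add)
  then show ?thesis
    using card_residue_class[of "p ^ j" "p ^ (k - j)" 0] assms
    by (simp add: cong_0_iff nat_power_eq)
qed

lemma three_not_dvd_square_cong: "\<not> 3 dvd (y::int) \<Longrightarrow> [y\<^sup>2 = 1] (mod 3)"
proof -
  assume "\<not> 3 dvd y"
  then have "y mod 3 = 1 \<or> y mod 3 = 2" by presburger
  then have "(y mod 3)\<^sup>2 mod 3 = 1" by auto
  then show ?thesis by (simp add: cong_def power_mod)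
qed

lemma prime_three_int: "prime (3::int)"
  by simp

lemma three_power_decomp:
  fixes x :: int
  assumes "x \<noteq> 0"
  obtains l y where "x = 3 ^ l * y" "\<not> 3 dvd y"
proof -
  have "\<not> is_unit (3::int)" by simp
  with assms show ?thesis using that multiplicity_decompose'[of x 3] by metis
qed

lemma three_power_dvd_iff:
  fixes y :: int
  assumes "\<not> 3 dvd y"
  shows "3 ^ k dvd 3 ^ l * y \<longleftrightarrow> k \<le> l"
proof
  assume dv: "3 ^ k dvd 3 ^ l * y"
  show "k \<le> l"
  proof (rule ccontr)
    assume "\<not> k \<le> l"
    then have "(3::int) ^ Suc l dvd 3 ^ l * y"
      using dv by (meson dvd_trans le_imp_power_dvd not_less_eq_eq)
    then show False using assms by (simp add: mult.commute)
  qed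
qed (simp add: le_imp_power_dvd)

lemma three_power_dvd_mult_unit:
  fixes a b :: int
  assumes "\<not> 3 dvd a"
  shows "3 ^ k dvd a * b \<longleftrightarrow> 3 ^ k dvd b"
proof -
  have "coprime (3 ^ k) a" using assms prime_imp_coprime[OF prime_three_int] by auto
  then show ?thesis by (rule coprime_dvd_mult_right_iff)
qed

text \<open>Hensel lifting from the root 1 modulo 3.\<close>

lemma sqrt_mod_three_power_exists:
  fixes c :: int
  assumes "[c = 1] (mod 3)"
  shows "\<exists>r. \<not> 3 dvd r \<and> [r\<^sup>2 = c] (mod 3 ^ Suc j)"
proof (induction j)
  case 0
  show ?case using assms by (intro exI[of _ 1]) (auto simp: cong_sym_eq)
next
  case (Suc j)
  then obtain r where r: "\<not> 3 dvd r" "[r\<^sup>2 = c] (mod 3 ^ Suc j)" by blast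
  then obtain t where t: "r\<^sup>2 - c = 3 ^ Suc j * t"
    by (auto simp: cong_iff_dvd_diff dvd_def)
  obtain q where q: "r\<^sup>2 - 1 = 3 * q"
    using three_not_dvd_square_cong[OF r(1)] by (auto simp: cong_iff_dvd_diff dvd_def)
  \<comment> \<open>Newton step: a correction x must satisfy t + 2 r x = 0 modulo 3. Since -2 is 1
    and r is its own inverse modulo 3, x = t r works.\<close>
  define s where "s = r + 3 ^ Suc j * (t * r)"
  have "s\<^sup>2 - c = 3 ^ Suc j * (t + 2 * t * r\<^sup>2 + 3 ^ Suc j * (t * r)\<^sup>2)"
  proof -
    have c: "c = r\<^sup>2 - 3 ^ Suc j * t" using t by simp
    show ?thesis unfolding s_def c by (simp add: power2_eq_square algebra_simps)
  qed
  also have "t + 2 * t * r\<^sup>2 + 3 ^ Suc j * (t * r)\<^sup>2 = 3 * (t + 2 * t * q + 3 ^ j * (t * r)\<^sup>2)"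
  proof -
    have "r\<^sup>2 = 1 + 3 * q" using q by simp
    then show ?thesis by (simp add: algebra_simps power_mult_distrib)
  qed
  finally have "[s\<^sup>2 = c] (mod 3 ^ Suc (Suc j))"
    by (simp add: cong_iff_dvd_diff)
  moreover have "\<not> 3 dvd s"
    using r(1) unfolding s_def by (simp add: dvd_add_left_iff)
  ultimately show ?case by blast
qed

text \<open>The factors y - r and y + r differ by 2 r, so 3 divides at most one of them, and the
  other absorbs no power of 3.\<close>

lemma square_eq_mod_three_power_iff:
  fixes r y :: int
  assumes "\<not> 3 dvd r" "j > 0"
  shows "[y\<^sup>2 = r\<^sup>2] (mod 3 ^ j) \<longleftrightarrow> [y = r] (mod 3 ^ j) \<or> [y = - r] (mod 3 ^ j)"
proof -
  have fac: "y\<^sup>2 - r\<^sup>2 = (y - r) * (y + r)" by (simp add: power2_eq_square algebra_simps)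
  have "\<not> 3 dvd y - r \<or> \<not> 3 dvd y + r" using assms(1) by presburger
  then have "3 ^ j dvd (y - r) * (y + r) \<longleftrightarrow> 3 ^ j dvd y - r \<or> 3 ^ j dvd y + r"
    using three_power_dvd_mult_unit[of "y - r" j "y + r"] three_power_dvd_mult_unit[of "y + r" j "y - r"]
    by (metis dvd_mult dvd_mult2 mult.commute)
  then show ?thesis unfolding cong_iff_dvd_diff fac by simp
qed

text \<open>Roots are restricted to multiples of \<open>3 ^ \<delta>\<close> because these are the
  residues taken by the \<open>lucas_v\<close> terms at odd indices.\<close>

definition square_count :: "nat \<Rightarrow> nat \<Rightarrow> int \<Rightarrow> nat" where
  "square_count \<delta> k c = card {x \<in> {0..<3 ^ k}. 3 ^ \<delta> dvd x \<and> [x\<^sup>2 = c] (mod 3 ^ k)}"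

text \<open>The valuation of a square is even; \<open>(k + 1) div 2\<close> is half of
  \<open>k\<close>, rounded up.\<close>

lemma three_power_dvd_square_iff:
  fixes x :: int
  shows "3 ^ k dvd x\<^sup>2 \<longleftrightarrow> 3 ^ ((k + 1) div 2) dvd x"
proof (cases "x = 0")
  case False
  then obtain l y where x: "x = 3 ^ l * y" "\<not> 3 dvd y" by (rule three_power_decomp)
  have "\<not> 3 dvd y\<^sup>2" using x(2) prime_dvd_power[OF prime_three_int] by blast
  moreover have "x\<^sup>2 = 3 ^ (2 * l) * y\<^sup>2" by (simp add: x power_mult_distrib power_mult mult.commute[of 2])
  ultimately have "3 ^ k dvd x\<^sup>2 \<longleftrightarrow> k \<le> 2 * l" by (simp add: three_power_dvd_iff)
  then show ?thesis using x by (simp add: three_power_dvd_iff) linarith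
qed simp

text \<open>The roots are the common multiples of \<open>3 ^ \<delta>\<close> and
  \<open>3 ^ ((k + 1) div 2)\<close>, that is, the multiples of the larger power.\<close>

lemma square_count_zero:
  assumes "3 ^ k dvd c" "\<delta> \<le> k"
  shows "square_count \<delta> k c = 3 ^ (k - max \<delta> ((k + 1) div 2))"
proof -
  have "3 ^ \<delta> dvd x \<and> [x\<^sup>2 = c] (mod 3 ^ k) \<longleftrightarrow> 3 ^ max \<delta> ((k + 1) div 2) dvd x" for x :: int
  proof -
    have "[x\<^sup>2 = c] (mod 3 ^ k) \<longleftrightarrow> 3 ^ ((k + 1) div 2) dvd x"
      using assms(1) three_power_dvd_square_iff[of k x] by (meson cong_dvd_iff cong_0_iff cong_sym cong_trans)
    then show ?thesis
      by (metis (no_types, lifting) dvd_trans le_imp_power_dvd max.cobounded1 max.cobounded2 max_def)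
  qed
  then show ?thesis unfolding square_count_def
    using card_multiples_power[of 3 "max \<delta> ((k + 1) div 2)" k] assms(2) by (cases k) auto
qed

lemma square_cong_three_power:
  fixes y :: int
  assumes "\<not> 3 dvd y"
  shows "[(3 ^ l * y)\<^sup>2 = 3 ^ (2 * l)] (mod 3 ^ (2 * l + 1))"
proof -
  have "3 dvd y\<^sup>2 - 1" using three_not_dvd_square_cong[OF assms] by (simp add: cong_iff_dvd_diff)
  then have "3 ^ (2 * l) * 3 dvd 3 ^ (2 * l) * (y\<^sup>2 - 1)" by (rule mult_dvd_mono[OF dvd_refl])
  also have "3 ^ (2 * l) * (y\<^sup>2 - 1) = (3 ^ l * y)\<^sup>2 - 3 ^ (2 * l)"
    by (simp add: power_mult_distrib power_mult mult.commute[of 2] algebra_simps)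
  finally show ?thesis by (simp add: cong_iff_dvd_diff mult.commute)
qed

text \<open>The witness is the 3-adic valuation of a root: it is at least \<open>\<delta>\<close>,
  and its double stays below \<open>k\<close> because \<open>c\<close> is nonzero modulo
  \<open>3 ^ k\<close>.\<close>

lemma square_count_nonzeroD:
  assumes "square_count \<delta> k c \<noteq> 0" "\<not> 3 ^ k dvd c"
  shows "\<exists>l\<in>{\<delta>..(k - 1) div 2}. [c = 3 ^ (2 * l)] (mod 3 ^ (2 * l + 1))"
proof -
  have "{x \<in> {0..<3 ^ k}. 3 ^ \<delta> dvd x \<and> [x\<^sup>2 = c] (mod 3 ^ k)} \<noteq> {}"
    using assms(1) unfolding square_count_def by (metis card.empty)
  then obtain x :: int where x: "3 ^ \<delta> dvd x" "[x\<^sup>2 = c] (mod 3 ^ k)" by blast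
  have nd: "\<not> 3 ^ k dvd x\<^sup>2" using x(2) assms(2) cong_dvd_iff by blast
  then have "x \<noteq> 0" by auto
  then obtain l y where xl: "x = 3 ^ l * y" "\<not> 3 dvd y" by (rule three_power_decomp)
  have "\<delta> \<le> l" using x(1) xl by (simp add: three_power_dvd_iff)
  moreover have lk: "2 * l < k"
    using nd xl unfolding three_power_dvd_square_iff by (simp add: three_power_dvd_iff)
  moreover have "[x\<^sup>2 = c] (mod 3 ^ (2 * l + 1))"
    using lk by (intro cong_dvd_modulus[OF x(2)] le_imp_power_dvd) simp
  then have "[c = 3 ^ (2 * l)] (mod 3 ^ (2 * l + 1))"
    using square_cong_three_power[OF xl(2), of l] xl(1) cong_trans cong_sym by blast
  ultimately show ?thesis by (intro bexI[of _ l]) auto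
qed

text \<open>Dividing out 3^(2 l) leaves a unit that is 1 modulo 3, with exactly two square roots r
  and -r modulo 3^(k - 2 l). Each of them accounts for 3^l roots x = 3^l y below 3^k.\<close>

lemma square_count_nonzero:
  assumes "\<delta> \<le> l" "2 * l < k" "[c = 3 ^ (2 * l)] (mod 3 ^ (2 * l + 1))"
  shows "square_count \<delta> k c = 2 * 3 ^ l"
proof -
  define j where "j = k - 2 * l"
  have j: "j > 0" "k = j + 2 * l" using assms by (auto simp: j_def)
  obtain t where t: "c - 3 ^ (2 * l) = 3 ^ (2 * l + 1) * t"
    using assms(3) by (auto simp: cong_iff_dvd_diff dvd_def)
  define c' where "c' = 1 + 3 * t"
  have c: "c = 3 ^ (2 * l) * c'" using t by (simp add: c'_def algebra_simps)
  have "[c' = 1] (mod 3)" by (simp add: c'_def cong_iff_dvd_diff)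
  then obtain r where r: "\<not> 3 dvd r" "[r\<^sup>2 = c'] (mod 3 ^ j)"
    using sqrt_mod_three_power_exists[of c' "j - 1"] j by auto
  have sq: "[(3 ^ l * y)\<^sup>2 = c] (mod 3 ^ k) \<longleftrightarrow> [y = r] (mod 3 ^ j) \<or> [y = - r] (mod 3 ^ j)" for y
  proof -
    have "(3 ^ l * y)\<^sup>2 - c = 3 ^ (2 * l) * (y\<^sup>2 - c')"
      by (simp add: c power_mult_distrib power_mult mult.commute[of 2] algebra_simps)
    then have "[(3 ^ l * y)\<^sup>2 = c] (mod 3 ^ k) \<longleftrightarrow> [y\<^sup>2 = c'] (mod 3 ^ j)"
      unfolding cong_iff_dvd_diff j power_add by (simp add: mult.commute)
    also have "\<dots> \<longleftrightarrow> [y\<^sup>2 = r\<^sup>2] (mod 3 ^ j)" using r(2) cong_sym cong_trans by blast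
    finally show ?thesis using square_eq_mod_three_power_iff[OF r(1) j(1)] by simp
  qed
  have pow: "(3::int) ^ k = 3 ^ l * 3 ^ (j + l)" by (simp add: j mult_2 flip: power_add)
  \<comment> \<open>The bound x < 3^k becomes y < 3^(j + l), a range holding \<open>3 ^ l\<close>
    members of each class modulo \<open>3 ^ j\<close>.\<close>
  define Y where "Y s = {y \<in> {0..<3 ^ (j + l)}. [y = s] (mod 3 ^ j)}" for s :: int
  have "{x \<in> {0..<3 ^ k}. 3 ^ \<delta> dvd x \<and> [x\<^sup>2 = c] (mod 3 ^ k)} = (\<lambda>y. 3 ^ l * y) ` (Y r \<union> Y (- r))"
    (is "?A = ?B")
  proof
    show "?A \<subseteq> ?B"
    proof
      fix x assume x: "x \<in> ?A"
      have "(3::int) ^ (2 * l) dvd 3 ^ k" by (simp add: j le_imp_power_dvd)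
      moreover have "[x\<^sup>2 = c] (mod 3 ^ k)" using x by simp
      ultimately have "[x\<^sup>2 = c] (mod 3 ^ (2 * l))" by (rule cong_dvd_modulus[rotated])
      then have "3 ^ (2 * l) dvd x\<^sup>2" using c cong_dvd_iff by (metis dvd_triv_left)
      then have "3 ^ l dvd x" unfolding three_power_dvd_square_iff by simp
      then obtain y where y: "x = 3 ^ l * y" by (rule dvdE)
      have "0 \<le> y" "y < 3 ^ (j + l)"
      proof -
        have "0 \<le> 3 ^ l * y" "3 ^ l * y < 3 ^ l * 3 ^ (j + l)"
          using x unfolding y pow by auto
        then show "0 \<le> y" "y < 3 ^ (j + l)" by (simp_all add: zero_le_mult_iff power_le_zero_eq)
      qed
      then show "x \<in> ?B" using x sq[of y] by (auto simp: y Y_def)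
    qed
    show "?B \<subseteq> ?A"
    proof
      fix x assume "x \<in> ?B"
      then obtain y where y: "x = 3 ^ l * y" "y \<in> Y r \<union> Y (- r)" by blast
      have "3 ^ \<delta> dvd x" using assms(1) y by (simp add: le_imp_power_dvd)
      moreover have "0 \<le> x" "x < 3 ^ k" 
        using y(2) unfolding y(1) pow by (auto simp: Y_def)
      moreover have "[x\<^sup>2 = c] (mod 3 ^ k)" using sq[of y] y by (auto simp: Y_def)
      ultimately show "x \<in> ?A" by simp
    qed
  qed
  moreover have "inj_on (\<lambda>y. 3 ^ l * y) (Y r \<union> Y (- r))" by (auto simp: inj_on_def)
  moreover have "Y r \<inter> Y (- r) = {}"
  proof (rule ccontr)
    assume "Y r \<inter> Y (- r) \<noteq> {}"
    then obtain y where "[y = r] (mod 3 ^ j)" "[y = - r] (mod 3 ^ j)" unfolding Y_def by blast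
    then have "[r = - r] (mod 3 ^ j)" using cong_trans cong_sym by blast
    then have "3 ^ j dvd r - (- r)" by (simp only: cong_iff_dvd_diff)
    moreover have "(3::int) dvd 3 ^ j" using j by simp
    ultimately have "3 dvd r - (- r)" using dvd_trans by blast
    then show False using r(1) by presburger
  qed
  moreover have "card (Y s) = 3 ^ l" for s
    using card_residue_class[of "3 ^ j" "3 ^ l" s] by (simp add: Y_def power_add nat_power_eq)
  moreover have "finite (Y s)" for s unfolding Y_def by (rule finite_subset[of _ "{0..<3 ^ (j + l)}"]) auto
  ultimately show ?thesis unfolding square_count_def by (simp add: card_image card_Un_disjoint)
qed

section \<open>Counting over one period, split by the parity of the index\<close>

lemma card_parity:
  "card {n. n < 2 * m \<and> even n} = m" "card {n. n < 2 * m \<and> odd n} = m"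
proof -
  have "{n. n < 2 * m \<and> even n} = (\<lambda>i. 2 * i) ` {..<m}" by (auto elim!: evenE)
  then show "card {n. n < 2 * m \<and> even n} = m" by (simp add: card_image inj_on_def)
  have "{n. n < 2 * m \<and> odd n} = (\<lambda>i. Suc (2 * i)) ` {..<m}" by (auto elim!: oddE)
  then show "card {n. n < 2 * m \<and> odd n} = m" by (simp add: card_image inj_on_def)
qed

lemma card_bij_betw_filter:
  assumes "bij_betw f A B" "\<And>x. x \<in> A \<Longrightarrow> R x \<longleftrightarrow> Q (f x)"
  shows "card {x \<in> A. R x} = card {y \<in> B. Q y}"
proof -
  have "f ` {x \<in> A. R x} = {y \<in> B. Q y}" using assms unfolding bij_betw_def by auto
  moreover have "inj_on f {x \<in> A. R x}" using assms(1) unfolding bij_betw_def inj_on_def by auto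
  ultimately show ?thesis using card_image by metis
qed

text \<open>As \<open>\<delta> \<le> k\<close>, a residue class modulo \<open>3 ^ k\<close> consists
  entirely of multiples of \<open>3 ^ \<delta>\<close> or contains none.\<close>

lemma card_multiples_cong:
  fixes b :: int
  assumes "\<delta> \<le> k"
  shows "card {x \<in> {x \<in> {0..<3 ^ k}. 3 ^ \<delta> dvd x}. [x = b] (mod 3 ^ k)} = (if 3 ^ \<delta> dvd b then 1 else 0)"
proof -
  have dvd_iff: "3 ^ \<delta> dvd x \<longleftrightarrow> 3 ^ \<delta> dvd b" if "[x = b] (mod 3 ^ k)" for x
    using cong_dvd_modulus[OF that le_imp_power_dvd[OF assms]] by (rule cong_dvd_iff)
  have key: "x \<in> {0..<3 ^ k} \<and> [x = b] (mod 3 ^ k) \<longleftrightarrow> x = b mod 3 ^ k" for x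
    by (auto simp: cong_def)
  have "x \<in> {x \<in> {x \<in> {0..<3 ^ k}. 3 ^ \<delta> dvd x}. [x = b] (mod 3 ^ k)} \<longleftrightarrow>
      x \<in> (if 3 ^ \<delta> dvd b then {b mod 3 ^ k} else {})" for x
    unfolding mem_Collect_eq using key[of x] dvd_iff[of x] by (cases "3 ^ \<delta> dvd b") (simp_all, blast+)
  then have eq: "{x \<in> {x \<in> {0..<3 ^ k}. 3 ^ \<delta> dvd x}. [x = b] (mod 3 ^ k)} =
      (if 3 ^ \<delta> dvd b then {b mod 3 ^ k} else {})" by blast
  show ?thesis unfolding eq by simp
qed

text \<open>Equal doubles modulo 2 m agree modulo m; both arguments are odd, so for odd m they agree
  modulo 2 m. Surjectivity follows by counting.\<close>

lemma bij_double:
  fixes m :: nat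
  assumes "odd m"
  shows "bij_betw (\<lambda>n. 2 * n mod (2 * m)) {n. n < 2 * m \<and> odd n} {n. n < 2 * m \<and> even n}"
proof -
  have m: "m > 0" using assms by (auto intro: Nat.gr0I)
  have "inj_on (\<lambda>n. 2 * n mod (2 * m)) {n. n < 2 * m \<and> odd n}"
  proof (rule inj_onI)
    fix x y assume xy: "x \<in> {n. n < 2 * m \<and> odd n}" "y \<in> {n. n < 2 * m \<and> odd n}"
      "2 * x mod (2 * m) = 2 * y mod (2 * m)"
    then have "[x = y] (mod m)" by (simp add: cong_def)
    moreover have "[x = y] (mod 2)" using xy by (simp add: cong_def odd_iff_mod_2_eq_one)
    moreover have "coprime m 2" using assms by simp
    ultimately have "[x = y] (mod (m * 2))" by (rule coprime_cong_mult_nat)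
    then show "x = y" using xy by (auto simp: cong_def mult.commute)
  qed
  moreover from this have "(\<lambda>n. 2 * n mod (2 * m)) ` {n. n < 2 * m \<and> odd n} = {n. n < 2 * m \<and> even n}"
    using m by (intro card_subset_eq) (auto simp: card_image card_parity)
  ultimately show ?thesis by (simp add: bij_betw_def)
qed

lemma cong_mod_period:
  fixes s :: "nat \<Rightarrow> int" and h :: nat
  assumes "\<And>n. [s (n + h) = s n] (mod m)"
  shows "[s (n mod h) = s n] (mod m)"
proof -
  have "[s (i + h * j) = s i] (mod m)" for i j :: nat
  proof (induction j)
    case (Suc j)
    have "[s (i + h * j + h) = s (i + h * j)] (mod m)" by (rule assms)
    from cong_trans[OF this Suc.IH] show ?case by (simp add: algebra_simps)
  qed simp
  from this[of "n mod h" "n div h"] show ?thesis by (simp add: cong_sym_eq)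
qed

lemma residue_count_split:
  fixes s :: "nat \<Rightarrow> int"
  assumes "period_mod s m = h"
  shows "residue_count s m b = card {n \<in> {n. n < h \<and> even n}. [s n = b] (mod int m)}
    + card {n \<in> {n. n < h \<and> odd n}. [s n = b] (mod int m)}"
proof -
  have "{n. n < h \<and> [s n = b] (mod int m)} = {n \<in> {n. n < h \<and> even n}. [s n = b] (mod int m)} \<union>
    {n \<in> {n. n < h \<and> odd n}. [s n = b] (mod int m)}" by auto
  moreover have "{n \<in> {n. n < h \<and> even n}. [s n = b] (mod int m)} \<inter>
    {n \<in> {n. n < h \<and> odd n}. [s n = b] (mod int m)} = {}" by auto
  ultimately show ?thesis unfolding residue_count_def assms by (simp add: card_Un_disjoint)
qed

lemma square_count_eq_0I:
  assumes "\<not> 3 ^ k dvd c" "\<And>l. l \<in> {\<delta>..(k - 1) div 2} \<Longrightarrow> \<not> [c = 3 ^ (2 * l)] (mod 3 ^ (2 * l + 1))"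
  shows "square_count \<delta> k c = 0"
  using square_count_nonzeroD[of \<delta> k c] assms by blast

lemma cong_three_power_imp_three_dvd: "[a = (b::int)] (mod 3 ^ j) \<Longrightarrow> j \<ge> 1 \<Longrightarrow> 3 dvd a - b"
  using dvd_trans[of 3 "3 ^ j" "a - b"] by (auto simp: cong_iff_dvd_diff)

subsection \<open>Periods and frequencies modulo powers of 3\<close>

locale lucas_three =
  fixes P :: int and \<delta> :: nat
  assumes \<delta>_pos: "\<delta> \<ge> 1" and dvd_P: "3 ^ \<delta> dvd P" and not_dvd_P: "\<not> 3 ^ (\<delta> + 1) dvd P"
begin

abbreviation "u \<equiv> lucas_u P"
abbreviation "v \<equiv> lucas_v P"

text \<open>
  Both differences \<open>u (n + 2 d) - u n\<close> and \<open>v (n + 2 d) - v n\<close> factor through \<open>w d\<close>, whose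
  3-adic valuation is \<open>\<delta>\<close> plus that of \<open>d\<close>.
\<close>
definition w :: "nat \<Rightarrow> int" where
  "w d = (if even d then u d else v d)"

lemma three_dvd_P: "3 dvd P"
  using dvd_trans[OF dvd_power[of \<delta> 3] dvd_P] \<delta>_pos by simp

lemma square_P_dvd: "3 ^ (\<delta> + 1) dvd P\<^sup>2"
  using mult_dvd_mono[OF dvd_P three_dvd_P] by (simp add: power2_eq_square mult.commute)

lemma D_unit: "\<not> 3 dvd P\<^sup>2 + 4"
proof -
  have "3 dvd P\<^sup>2" using three_dvd_P by (simp add: power2_eq_square)
  then show ?thesis by presburger
qed

lemma u_odd: "odd n \<Longrightarrow> 3 dvd u n - 1"
  using lucas_mod_square[of P "n div 2"] by (intro dvd_trans[OF three_dvd_P]) simp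

lemma v_even: "even n \<Longrightarrow> 3 dvd v n - 2"
  using lucas_mod_square[of P "n div 2"] by (intro dvd_trans[OF three_dvd_P]) simp

lemma u_odd_unit: "odd n \<Longrightarrow> \<not> 3 dvd u n"
  using u_odd[of n] by presburger

lemma v_even_unit: "even n \<Longrightarrow> \<not> 3 dvd v n"
  using v_even[of n] by presburger

lemma dvd_u_even: "even n \<Longrightarrow> 3 ^ \<delta> dvd u n"
proof (elim evenE)
  fix m assume n: "n = 2 * m"
  have "P dvd u (2 * m) - int m * P"
    using lucas_mod_square[of P m] by (meson dvd_power dvd_trans pos2)
  then have "P dvd u n" unfolding n by (metis dvd_diff_left_iff dvd_triv_right)
  then show ?thesis by (rule dvd_trans[OF dvd_P])
qed

lemma dvd_v_odd: "odd n \<Longrightarrow> 3 ^ \<delta> dvd v n"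
proof (elim oddE)
  fix m assume n: "n = 2 * m + 1"
  have "P dvd v (Suc (2 * m)) - int (Suc (2 * m)) * P"
    using lucas_mod_square[of P m] by (meson dvd_power dvd_trans pos2)
  then have "P dvd v n" unfolding n by (metis Suc_eq_plus1 dvd_diff_left_iff dvd_triv_right)
  then show ?thesis by (rule dvd_trans[OF dvd_P])
qed

text \<open>Base case of the valuation formula: at indices prime to 3 the valuation is exactly that
  of \<open>P\<close>.\<close>

lemma w_unit_index:
  assumes "\<not> 3 dvd e"
  shows "3 ^ \<delta> dvd w e \<and> \<not> 3 ^ (\<delta> + 1) dvd w e"
proof
  show "3 ^ \<delta> dvd w e" using dvd_u_even dvd_v_odd by (simp add: w_def)
  \<comment> \<open>The multiplier is half the index for even \<open>e\<close> and the index itself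
    for odd \<open>e\<close>; both are prime to 3.\<close>
  have "\<exists>i::nat. \<not> 3 dvd i \<and> 3 ^ (\<delta> + 1) dvd w e - int i * P"
  proof (cases "even e")
    case True
    then obtain n where n: "e = 2 * n" by (elim evenE)
    have "\<not> 3 dvd n" using assms n by auto
    moreover have "3 ^ (\<delta> + 1) dvd w e - int n * P"
      using lucas_mod_square[of P n] dvd_trans[OF square_P_dvd] by (simp add: n w_def)
    ultimately show ?thesis by blast
  next
    case False
    then obtain n where n: "e = Suc (2 * n)" by (metis oddE Suc_eq_plus1)
    have "3 ^ (\<delta> + 1) dvd w e - int e * P"
      using lucas_mod_square[of P n] dvd_trans[OF square_P_dvd] unfolding w_def n by simp
    then show ?thesis using assms by blast
  qed
  then obtain i :: nat where i: "\<not> 3 dvd i" "3 ^ (\<delta> + 1) dvd w e - int i * P" by blast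
  show "\<not> 3 ^ (\<delta> + 1) dvd w e"
  proof
    assume "3 ^ (\<delta> + 1) dvd w e"
    with i(2) have "3 ^ (\<delta> + 1) dvd int i * P" by (metis dvd_diff_right_iff)
    moreover have "\<not> 3 dvd int i" using i(1) by presburger
    ultimately show False using three_power_dvd_mult_unit not_dvd_P by blast
  qed
qed

text \<open>In the tripling formulas the square of a multiple of 3 contributes a factor 9, so after
  removing one 3 the cofactor is 1 modulo 3.\<close>

lemma w_triple: "3 dvd w d \<Longrightarrow> \<exists>t. w (3 * d) = 3 * w d * (1 + 3 * t)"
proof -
  assume "3 dvd w d"
  then obtain s where s: "w d = 3 * s" by (elim dvdE)
  show ?thesis
  proof (cases "even d")
    case True
    then have "w (3 * d) = 3 * w d * (1 + 3 * ((P\<^sup>2 + 4) * s\<^sup>2))"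
      using s lucas_u_triple_even[OF True, of P] by (simp add: w_def power2_eq_square algebra_simps)
    then show ?thesis by blast
  next
    case False
    then have "w (3 * d) = 3 * w d * (1 + 3 * s\<^sup>2)"
      using s lucas_v_triple_odd[OF False, of P] by (simp add: w_def power2_eq_square algebra_simps)
    then show ?thesis by blast
  qed
qed

lemma w_decomp:
  assumes "\<not> 3 dvd e"
  shows "\<exists>q. w (3 ^ j * e) = 3 ^ (\<delta> + j) * q \<and> \<not> 3 dvd q"
proof (induction j)
  case 0
  show ?case using w_unit_index[OF assms] by (auto elim!: dvdE)
next
  case (Suc j)
  then obtain q where q: "w (3 ^ j * e) = 3 ^ (\<delta> + j) * q" "\<not> 3 dvd q" by blast
  have "3 dvd w (3 ^ j * e)" using q \<delta>_pos by simp
  then obtain t where t: "w (3 * (3 ^ j * e)) = 3 * w (3 ^ j * e) * (1 + 3 * t)"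
    using w_triple by blast
  have "\<not> 3 dvd q * (1 + 3 * t)"
  proof
    assume "3 dvd q * (1 + 3 * t)"
    then have "3 dvd q \<or> 3 dvd 1 + 3 * t" using prime_dvd_mult_iff[OF prime_three_int] by blast
    then show False using q(2) by presburger
  qed
  moreover have "w (3 ^ Suc j * e) = 3 ^ (\<delta> + Suc j) * (q * (1 + 3 * t))"
    using t q(1) by (simp add: mult_ac)
  ultimately show ?case by blast
qed

text \<open>This is the valuation formula for \<open>w\<close>. For \<open>k \<le> \<delta>\<close>
  the truncated difference is 0 and both sides hold for every \<open>d\<close>.\<close>

lemma three_power_dvd_w_iff:
  "3 ^ k dvd w d \<longleftrightarrow> 3 ^ (k - \<delta>) dvd d"
proof (cases "d = 0")
  case True
  then show ?thesis by (simp add: w_def)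
next
  case False
  moreover have "\<not> is_unit (3::nat)" by simp
  ultimately obtain j e where d: "d = 3 ^ j * e" "\<not> 3 dvd e"
    using multiplicity_decompose'[of d 3] by metis
  obtain q where "w d = 3 ^ (\<delta> + j) * q" "\<not> 3 dvd q" using w_decomp[OF d(2)] d(1) by blast
  then have "3 ^ k dvd w d \<longleftrightarrow> k \<le> \<delta> + j" by (simp add: three_power_dvd_iff)
  also have "\<dots> \<longleftrightarrow> k - \<delta> \<le> j" by linarith
  also have "\<dots> \<longleftrightarrow> (3::int) ^ (k - \<delta>) dvd 3 ^ j * int e"
  proof -
    have "\<not> 3 dvd int e" using d(2) by presburger
    then show ?thesis by (simp add: three_power_dvd_iff)
  qed
  also have "\<dots> \<longleftrightarrow> 3 ^ (k - \<delta>) dvd d"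
    unfolding d(1) int_dvd_int_iff[symmetric] by simp
  finally show ?thesis .
qed

lemma w_dvd_diff: "w d dvd u (n + 2 * d) - u n" "w d dvd v (n + 2 * d) - v n"
proof -
  show "w d dvd u (n + 2 * d) - u n"
    by (cases "even d") (simp_all add: w_def lucas_u_diff_even lucas_u_diff_odd del: lucas_u.simps)
  show "w d dvd v (n + 2 * d) - v n"
    by (cases "even d") (simp_all add: w_def lucas_v_diff_even lucas_v_diff_odd del: lucas_v.simps)
qed

text \<open>For even \<open>n\<close> the cofactor of \<open>w d\<close> is \<open>v (n + d)\<close>
  at an even index or \<open>u (n + d)\<close> at an odd one, hence prime to 3.\<close>

lemma u_even_cong_iff:
  assumes "even n"
  shows "[u (n + 2 * d) = u n] (mod 3 ^ k) \<longleftrightarrow> 3 ^ (k - \<delta>) dvd d"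
proof -
  have "\<exists>a. \<not> 3 dvd a \<and> u (n + 2 * d) - u n = a * w d"
    using assms v_even_unit[of "n + d"] u_odd_unit[of "n + d"] lucas_u_diff_even[of d P n] lucas_u_diff_odd[of d P n]
    by (cases "even d") (auto simp: w_def)
  then show ?thesis
    unfolding cong_iff_dvd_diff three_power_dvd_w_iff[symmetric] using three_power_dvd_mult_unit by auto
qed

text \<open>For odd \<open>n\<close> the cofactor is \<open>(P\<^sup>2 + 4) * u (n + d)\<close> at
  an odd index or \<open>v (n + d)\<close> at an even one, again prime to 3.\<close>

lemma v_odd_cong_iff:
  assumes "odd n"
  shows "[v (n + 2 * d) = v n] (mod 3 ^ k) \<longleftrightarrow> 3 ^ (k - \<delta>) dvd d"
proof -
  have "\<exists>a. \<not> 3 dvd a \<and> v (n + 2 * d) - v n = a * w d"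
  proof (cases "even d")
    case True
    then have "\<not> 3 dvd (P\<^sup>2 + 4) * u (n + d)"
      using assms u_odd_unit[of "n + d"] D_unit prime_dvd_mult_iff[OF prime_three_int] by auto
    then show ?thesis using True lucas_v_diff_even[of d P n] by (auto simp: w_def)
  next
    case False
    then show ?thesis using assms v_even_unit[of "n + d"] lucas_v_diff_odd[of d P n] by (auto simp: w_def)
  qed
  then show ?thesis
    unfolding cong_iff_dvd_diff three_power_dvd_w_iff[symmetric] using three_power_dvd_mult_unit by auto
qed

section \<open>Shortest periods, and the residues taken within one parity class\<close>

lemma u_periodic: "[u (n + 2 * 3 ^ (k - \<delta>)) = u n] (mod 3 ^ k)"
  and v_periodic: "[v (n + 2 * 3 ^ (k - \<delta>)) = v n] (mod 3 ^ k)"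
proof -
  have "3 ^ k dvd w (3 ^ (k - \<delta>))" by (simp add: three_power_dvd_w_iff)
  then show "[u (n + 2 * 3 ^ (k - \<delta>)) = u n] (mod 3 ^ k)" "[v (n + 2 * 3 ^ (k - \<delta>)) = v n] (mod 3 ^ k)"
    unfolding cong_iff_dvd_diff using dvd_trans[OF _ w_dvd_diff(1)] dvd_trans[OF _ w_dvd_diff(2)] by auto
qed

lemma period_mod_u:
  assumes "k \<ge> 1"
  shows "period_mod u (3 ^ k) = 2 * 3 ^ (k - \<delta>)"
  unfolding period_mod_def
proof (rule Least_equality)
  show "0 < (2 * 3 ^ (k - \<delta>) :: nat) \<and> (\<forall>n. [u (n + 2 * 3 ^ (k - \<delta>)) = u n] (mod int (3 ^ k)))"
    unfolding of_nat_power of_nat_numeral by (intro conjI allI u_periodic) simp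
next
  fix h :: nat assume h: "0 < h \<and> (\<forall>n. [u (n + h) = u n] (mod int (3 ^ k)))"
  then have "\<forall>n. [u (n + h) = u n] (mod 3 ^ k)" by simp
  then have h0: "[u (0 + h) = u 0] (mod 3 ^ k)" by (rule spec)
  then have "3 ^ k dvd u h" by (simp add: cong_0_iff)
  moreover have "(3::int) dvd 3 ^ k" using assms by simp
  ultimately have "even h" using u_odd_unit[of h] dvd_trans[of 3 "3 ^ k" "u h"] by blast
  then obtain d where d: "h = 2 * d" by (elim evenE)
  then have "3 ^ (k - \<delta>) dvd d" using h0 u_even_cong_iff[of 0 d k] by simp
  then show "2 * 3 ^ (k - \<delta>) \<le> h" using d h by (auto intro: dvd_imp_le)
qed

lemma period_mod_v:
  assumes "k \<ge> 1"
  shows "period_mod v (3 ^ k) = 2 * 3 ^ (k - \<delta>)"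
  unfolding period_mod_def
proof (rule Least_equality)
  show "0 < (2 * 3 ^ (k - \<delta>) :: nat) \<and> (\<forall>n. [v (n + 2 * 3 ^ (k - \<delta>)) = v n] (mod int (3 ^ k)))"
    unfolding of_nat_power of_nat_numeral by (intro conjI allI v_periodic) simp
next
  fix h :: nat assume h: "0 < h \<and> (\<forall>n. [v (n + h) = v n] (mod int (3 ^ k)))"
  then have "\<forall>n. [v (n + h) = v n] (mod 3 ^ k)" by simp
  \<comment> \<open>Index 0 forces the period to be even. The exact criterion for \<open>v\<close>
    is available only at odd indices, so the length is then read off at index 1.\<close>
  then have h0: "[v (0 + h) = v 0] (mod 3 ^ k)" and h1: "[v (1 + h) = v 1] (mod 3 ^ k)"
    by (rule spec)+
  have three: "(3::int) dvd 3 ^ k" using assms by simp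
  have "[v h = 2] (mod 3)" using cong_dvd_modulus[OF h0 three] by simp
  then have "\<not> 3 dvd v h" using cong_dvd_iff by fastforce
  moreover have "(3::int) dvd 3 ^ \<delta>" using \<delta>_pos by simp
  ultimately have "even h" using dvd_v_odd[of h] dvd_trans[of 3 "3 ^ \<delta>" "v h"] by blast
  then obtain d where d: "h = 2 * d" by (elim evenE)
  then have "3 ^ (k - \<delta>) dvd d" using h1 v_odd_cong_iff[of 1 d k] by simp
  then show "2 * 3 ^ (k - \<delta>) \<le> h" using d h by (auto intro: dvd_imp_le)
qed

text \<open>Two indices in \<open>A\<close> differ by 2 d with d < 3^(k - \<delta>), so
  \<open>cong\<close> gives injectivity; \<open>A\<close> and the set of multiples have the same
  size. It serves both \<open>u\<close> on even and \<open>v\<close> on odd indices.\<close>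

lemma bij_betw_multiples:
  fixes s :: "nat \<Rightarrow> int" and A :: "nat set"
  assumes k: "\<delta> \<le> k"
    and A: "A \<subseteq> {..<2 * 3 ^ (k - \<delta>)}" "card A = 3 ^ (k - \<delta>)" "\<And>m n. m \<in> A \<Longrightarrow> n \<in> A \<Longrightarrow> even m \<longleftrightarrow> even n"
    and dv: "\<And>n. n \<in> A \<Longrightarrow> 3 ^ \<delta> dvd s n"
    and cong: "\<And>n d. n \<in> A \<Longrightarrow> [s (n + 2 * d) = s n] (mod 3 ^ k) \<Longrightarrow> 3 ^ (k - \<delta>) dvd d"
  shows "bij_betw (\<lambda>n. s n mod 3 ^ k) A {x \<in> {0..<3 ^ k}. 3 ^ \<delta> dvd x}"
proof -
  let ?S = "{x \<in> {0..<3 ^ k}. 3 ^ \<delta> dvd x} :: int set"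
  have le: "m = n" if "m \<in> A" "n \<in> A" "n \<le> m" "[s m = s n] (mod 3 ^ k)" for m n
  proof -
    have "even (m - n)" using A(3)[OF that(1,2)] that(3) by simp
    then obtain d where d: "m - n = 2 * d" by (elim evenE)
    then have m: "m = n + 2 * d" using that(3) by simp
    then have "3 ^ (k - \<delta>) dvd d" using cong that by simp
    moreover have "d < 3 ^ (k - \<delta>)" using that(1) A(1) m by auto
    ultimately have "d = 0" using nat_dvd_not_less by blast
    then show ?thesis using m by simp
  qed
  have inj: "inj_on (\<lambda>n. s n mod 3 ^ k) A"
  proof (rule inj_onI)
    fix m n assume "m \<in> A" "n \<in> A" "s m mod 3 ^ k = s n mod 3 ^ k"
    then show "m = n" using le[of m n] le[of n m] by (cases "n \<le> m") (auto simp: cong_def)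
  qed
  have "(\<lambda>n. s n mod 3 ^ k) ` A \<subseteq> ?S"
    using dv k by (auto simp: dvd_mod_iff le_imp_power_dvd)
  moreover have "card ((\<lambda>n. s n mod 3 ^ k) ` A) = card ?S"
    using card_image[OF inj] A(2) card_multiples_power[of 3 \<delta> k] k by simp
  ultimately have "(\<lambda>n. s n mod 3 ^ k) ` A = ?S"
    by (intro card_subset_eq finite_subset[of ?S "{0..<3 ^ k}"]) auto
  then show ?thesis using inj by (simp add: bij_betw_def)
qed



lemma bij_u_even:
  assumes "\<delta> \<le> k"
  shows "bij_betw (\<lambda>n. u n mod 3 ^ k) {n. n < 2 * 3 ^ (k - \<delta>) \<and> even n} {x \<in> {0..<3 ^ k}. 3 ^ \<delta> dvd x}"
proof (rule bij_betw_multiples[OF assms])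
  fix n :: nat assume n: "n \<in> {n. n < 2 * 3 ^ (k - \<delta>) \<and> even n}"
  then show "3 ^ \<delta> dvd u n" using dvd_u_even by blast
  show "3 ^ (k - \<delta>) dvd d" if "[u (n + 2 * d) = u n] (mod 3 ^ k)" for d
    using n that u_even_cong_iff by blast
qed (auto simp: card_parity)

lemma bij_v_odd:
  assumes "\<delta> \<le> k"
  shows "bij_betw (\<lambda>n. v n mod 3 ^ k) {n. n < 2 * 3 ^ (k - \<delta>) \<and> odd n} {x \<in> {0..<3 ^ k}. 3 ^ \<delta> dvd x}"
proof (rule bij_betw_multiples[OF assms])
  fix n :: nat assume n: "n \<in> {n. n < 2 * 3 ^ (k - \<delta>) \<and> odd n}"
  then show "3 ^ \<delta> dvd v n" using dvd_v_odd by blast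
  show "3 ^ (k - \<delta>) dvd d" if "[v (n + 2 * d) = v n] (mod 3 ^ k)" for d
    using n that v_odd_cong_iff by blast
qed (auto simp: card_parity)

section \<open>Frequencies expressed by square root counts\<close>

lemma residue_count_v:
  assumes "\<delta> \<le> k"
  shows "residue_count v (3 ^ k) b = (if 3 ^ \<delta> dvd b then 1 else 0) + square_count \<delta> k (b - 2)"
proof -
  let ?M = "3 ^ (k - \<delta>) :: nat"
  have k: "k \<ge> 1" using assms \<delta>_pos by simp
  \<comment> \<open>Odd indices contribute only multiples of \<open>3 ^ \<delta>\<close>, each
    residue once.\<close>
  have "card {n \<in> {n. n < 2 * ?M \<and> odd n}. [v n = b] (mod 3 ^ k)} = (if 3 ^ \<delta> dvd b then 1 else 0)"
    unfolding card_multiples_cong[OF assms, symmetric]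
    by (rule card_bij_betw_filter[OF bij_v_odd[OF assms]]) (simp add: cong_def)
  \<comment> \<open>Even indices are reached by doubling odd ones modulo the period, where
    \<open>v (2 * n) = (v n)\<^sup>2 + 2\<close>.\<close>
  moreover have "card {n \<in> {n. n < 2 * ?M \<and> odd n}. [(v n)\<^sup>2 = b - 2] (mod 3 ^ k)} =
    card {n \<in> {n. n < 2 * ?M \<and> even n}. [v n = b] (mod 3 ^ k)}"
  proof (rule card_bij_betw_filter[OF bij_double])
    fix n assume "n \<in> {n. n < 2 * ?M \<and> odd n}"
    then have "v (2 * n) = (v n)\<^sup>2 + 2" using lucas_v_double_odd by blast
    moreover have "[v (2 * n mod (2 * ?M)) = v (2 * n)] (mod 3 ^ k)"
      by (rule cong_mod_period) (rule v_periodic)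
    then have "[v (2 * n) = b] (mod 3 ^ k) \<longleftrightarrow> [v (2 * n mod (2 * ?M)) = b] (mod 3 ^ k)"
      by (simp add: cong_def)
    moreover have "[(v n)\<^sup>2 = b - 2] (mod 3 ^ k) \<longleftrightarrow> [(v n)\<^sup>2 + 2 = b] (mod 3 ^ k)"
      by (simp add: cong_iff_dvd_diff algebra_simps)
    ultimately show "[(v n)\<^sup>2 = b - 2] (mod 3 ^ k) \<longleftrightarrow> [v (2 * n mod (2 * ?M)) = b] (mod 3 ^ k)"
      by simp
  qed simp
  \<comment> \<open>The values \<open>v n\<close> at odd \<open>n\<close> are now replaced by the
    multiples of \<open>3 ^ \<delta>\<close>, which they run through once.\<close>
  moreover have "card {n \<in> {n. n < 2 * ?M \<and> odd n}. [(v n)\<^sup>2 = b - 2] (mod 3 ^ k)} =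
    card {x \<in> {x \<in> {0..<3 ^ k}. 3 ^ \<delta> dvd x}. [x\<^sup>2 = b - 2] (mod 3 ^ k)}"
    by (rule card_bij_betw_filter[OF bij_v_odd[OF assms]]) (simp add: cong_def power_mod)
  moreover have "\<dots> = square_count \<delta> k (b - 2)"
    unfolding square_count_def by (rule arg_cong[of _ _ card]) auto
  ultimately show ?thesis
    using residue_count_split[OF period_mod_v[OF k], of b] by simp
qed

text \<open>The difference of the two sides is (P^2 + 4)(a + b)(a - b), and a + b is 2 modulo 3.
  This makes the passage from \<open>u n\<close> to its square reversible.\<close>

lemma D_square_cong_iff:
  assumes "3 dvd a - 1" "3 dvd b - 1"
  shows "[(P\<^sup>2 + 4) * a\<^sup>2 - 4 = (P\<^sup>2 + 4) * b\<^sup>2 - 4] (mod 3 ^ j) \<longleftrightarrow> [a = b] (mod 3 ^ j)"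
proof -
  have "\<not> 3 dvd a + b" using assms by presburger
  then have "\<not> 3 dvd (P\<^sup>2 + 4) * (a + b)" using D_unit prime_dvd_mult_iff[OF prime_three_int] by blast
  moreover have "((P\<^sup>2 + 4) * a\<^sup>2 - 4) - ((P\<^sup>2 + 4) * b\<^sup>2 - 4) = ((P\<^sup>2 + 4) * (a + b)) * (a - b)"
    by (simp add: power2_eq_square algebra_simps)
  ultimately show ?thesis unfolding cong_iff_dvd_diff by (simp only: three_power_dvd_mult_unit not_False_eq_True)
qed

text \<open>Even indices give the multiples of \<open>3 ^ \<delta>\<close>. At odd indices
  \<open>u n\<close> is 1 modulo 3, so other \<open>b\<close> get nothing there; for the remaining
  \<open>b\<close> the condition is squared and becomes one on \<open>(v n)\<^sup>2\<close>.\<close>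

lemma residue_count_u:
  assumes "\<delta> \<le> k"
  shows "residue_count u (3 ^ k) b = (if 3 ^ \<delta> dvd b then 1 else 0)
    + (if 3 dvd b - 1 then square_count \<delta> k ((P\<^sup>2 + 4) * b\<^sup>2 - 4) else 0)"
proof -
  let ?M = "3 ^ (k - \<delta>) :: nat"
  have k: "k \<ge> 1" using assms \<delta>_pos by simp
  have "card {n \<in> {n. n < 2 * ?M \<and> even n}. [u n = b] (mod 3 ^ k)} = (if 3 ^ \<delta> dvd b then 1 else 0)"
    unfolding card_multiples_cong[OF assms, symmetric]
    by (rule card_bij_betw_filter[OF bij_u_even[OF assms]]) (simp add: cong_def)
  moreover have "card {n \<in> {n. n < 2 * ?M \<and> odd n}. [u n = b] (mod 3 ^ k)} =
    (if 3 dvd b - 1 then square_count \<delta> k ((P\<^sup>2 + 4) * b\<^sup>2 - 4) else 0)"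
  proof (cases "3 dvd b - 1")
    case True
    have "card {n \<in> {n. n < 2 * ?M \<and> odd n}. [u n = b] (mod 3 ^ k)} =
      card {x \<in> {x \<in> {0..<3 ^ k}. 3 ^ \<delta> dvd x}. [x\<^sup>2 = (P\<^sup>2 + 4) * b\<^sup>2 - 4] (mod 3 ^ k)}"
    proof (rule card_bij_betw_filter[OF bij_v_odd[OF assms]])
      fix n assume "n \<in> {n. n < 2 * ?M \<and> odd n}"
      then have n: "odd n" by simp
      have "[u n = b] (mod 3 ^ k) \<longleftrightarrow> [(P\<^sup>2 + 4) * (u n)\<^sup>2 - 4 = (P\<^sup>2 + 4) * b\<^sup>2 - 4] (mod 3 ^ k)"
        using D_square_cong_iff[OF u_odd[OF n] True] by simp
      also have "(P\<^sup>2 + 4) * (u n)\<^sup>2 - 4 = (v n)\<^sup>2" using lucas_u_square_odd[OF n, of P] by simp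
      finally show "[u n = b] (mod 3 ^ k) \<longleftrightarrow> [(v n mod 3 ^ k)\<^sup>2 = (P\<^sup>2 + 4) * b\<^sup>2 - 4] (mod 3 ^ k)"
        by (simp add: cong_def power_mod)
    qed
    moreover have "\<dots> = square_count \<delta> k ((P\<^sup>2 + 4) * b\<^sup>2 - 4)"
      unfolding square_count_def by (rule arg_cong[of _ _ card]) auto
    ultimately show ?thesis using True by simp
  next
    case False
    have "\<not> [u n = b] (mod 3 ^ k)" if "odd n" for n
    proof
      assume "[u n = b] (mod 3 ^ k)"
      then have "3 dvd u n - b" using k dvd_trans[of 3 "3 ^ k" "u n - b"]
        by (simp add: cong_iff_dvd_diff)
      then show False using u_odd[OF that] False by presburger
    qed
    then have "{n \<in> {n. n < 2 * ?M \<and> odd n}. [u n = b] (mod 3 ^ k)} = {}" by blast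
    then show ?thesis using False by (simp only: card.empty if_False)
  qed
  ultimately show ?thesis
    using residue_count_split[OF period_mod_u[OF k], of b] by simp
qed

section \<open>The residue classes of the theorem as conditions on squares\<close>

lemma v_three_power: "\<exists>q. v (3 ^ j) = 3 ^ (\<delta> + j) * q \<and> \<not> 3 dvd q"
  using w_decomp[of 1 j] by (simp add: w_def)

text \<open>The term \<open>v (3 ^ (l - \<delta>))\<close> has valuation exactly \<open>l\<close>,
  and the square of its unit part is 1 modulo 3.\<close>

lemma v_square_cong:
  assumes "\<delta> \<le> l"
  shows "[(v (3 ^ (l - \<delta>)))\<^sup>2 = 3 ^ (2 * l)] (mod 3 ^ (2 * l + 1))"
proof -
  obtain q where "v (3 ^ (l - \<delta>)) = 3 ^ l * q" "\<not> 3 dvd q"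
    using v_three_power[of "l - \<delta>"] assms by auto
  then show ?thesis using square_cong_three_power by simp
qed

text \<open>Doubling the odd index 3^(l - \<delta>) turns its square into the representative of the
  class of valuation 2 l.\<close>

lemma v_class_iff:
  assumes "\<delta> \<le> l"
  shows "[b = v (2 * 3 ^ (l - \<delta>))] (mod 3 ^ (2 * l + 1)) \<longleftrightarrow> [b - 2 = 3 ^ (2 * l)] (mod 3 ^ (2 * l + 1))"
proof -
  have "[b = v (2 * 3 ^ (l - \<delta>))] (mod 3 ^ (2 * l + 1)) \<longleftrightarrow> [b - 2 = (v (3 ^ (l - \<delta>)))\<^sup>2] (mod 3 ^ (2 * l + 1))"
    using lucas_v_double_odd[of "3 ^ (l - \<delta>)" P] by (simp add: cong_iff_dvd_diff algebra_simps)
  then show ?thesis using v_square_cong[OF assms] by (simp only: cong_def)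
qed

lemma u_class_iff:
  assumes "\<delta> \<le> l" "3 dvd b - 1"
  shows "[b = u (3 ^ (l - \<delta>))] (mod 3 ^ (2 * l + 1)) \<longleftrightarrow>
    [(P\<^sup>2 + 4) * b\<^sup>2 - 4 = 3 ^ (2 * l)] (mod 3 ^ (2 * l + 1))"
proof -
  have n: "odd (3 ^ (l - \<delta>) :: nat)" by simp
  have "[b = u (3 ^ (l - \<delta>))] (mod 3 ^ (2 * l + 1)) \<longleftrightarrow>
    [(P\<^sup>2 + 4) * b\<^sup>2 - 4 = (v (3 ^ (l - \<delta>)))\<^sup>2] (mod 3 ^ (2 * l + 1))"
    using D_square_cong_iff[OF assms(2) u_odd[OF n], of "2 * l + 1"] lucas_u_square_odd[OF n, of P] by simp
  then show ?thesis using v_square_cong[OF assms(1)] by (simp only: cong_def)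
qed

text \<open>The bound on \<open>k\<close> makes \<open>(v (3 ^ j))\<^sup>2\<close> vanish modulo
  \<open>3 ^ k\<close>, so every such \<open>j\<close> represents the same class.\<close>

lemma u_zero_class_iff:
  assumes "k \<le> 2 * (\<delta> + j)" "3 dvd b - 1"
  shows "[b = u (3 ^ j)] (mod 3 ^ k) \<longleftrightarrow> 3 ^ k dvd (P\<^sup>2 + 4) * b\<^sup>2 - 4"
proof -
  have n: "odd (3 ^ j :: nat)" by simp
  have "3 ^ (\<delta> + j) dvd v (3 ^ j)" using v_three_power[of j] by auto
  then have "3 ^ ((k + 1) div 2) dvd v (3 ^ j)"
    using assms(1) by (elim power_le_dvd) simp
  then have "[(v (3 ^ j))\<^sup>2 = 0] (mod 3 ^ k)"
    by (simp add: cong_0_iff three_power_dvd_square_iff)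
  moreover have "[b = u (3 ^ j)] (mod 3 ^ k) \<longleftrightarrow> [(P\<^sup>2 + 4) * b\<^sup>2 - 4 = (v (3 ^ j))\<^sup>2] (mod 3 ^ k)"
    using D_square_cong_iff[OF assms(2) u_odd[OF n]] lucas_u_square_odd[OF n, of P] by simp
  ultimately show ?thesis unfolding cong_0_iff[symmetric] by (simp only: cong_def)
qed


section \<open>Evaluation of the frequencies, case by case\<close>

lemma three_power_dvd_imp_three_dvd: "(3::int) ^ \<delta> dvd b \<Longrightarrow> 3 dvd b"
  using \<delta>_pos dvd_trans[of 3 "3 ^ \<delta>" b] by simp

text \<open>The square of a multiple of 3 cannot be a unit modulo 3. This separates the class of
  \<open>b = 0\<close> from the square root term for \<open>v\<close>.\<close>

lemma square_count_unit:
  assumes "\<delta> \<le> k" "\<not> 3 dvd c"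
  shows "square_count \<delta> k c = 0"
proof (rule square_count_eq_0I)
  show "\<not> 3 ^ k dvd c"
    using assms \<delta>_pos dvd_trans[of 3 "3 ^ k" c] by auto
  fix l assume l: "l \<in> {\<delta>..(k - 1) div 2}"
  show "\<not> [c = 3 ^ (2 * l)] (mod 3 ^ (2 * l + 1))"
  proof
    assume "[c = 3 ^ (2 * l)] (mod 3 ^ (2 * l + 1))"
    then have "3 dvd c - 3 ^ (2 * l)" by (rule cong_three_power_imp_three_dvd) simp
    moreover have "(3::int) dvd 3 ^ (2 * l)" using l \<delta>_pos by simp
    ultimately show False using assms(2) by (metis dvd_diff_left_iff)
  qed
qed

lemma v_count_zero_mod:
  assumes "\<delta> \<le> k" "[b = 0] (mod 3 ^ \<delta>)"
  shows "residue_count v (3 ^ k) b = 1"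
proof -
  have b: "3 ^ \<delta> dvd b" using assms(2) by (simp add: cong_0_iff)
  then have "3 dvd b" by (rule three_power_dvd_imp_three_dvd)
  then have "\<not> 3 dvd b - 2" by presburger
  then show ?thesis using residue_count_v[OF assms(1)] square_count_unit[OF assms(1)] b by simp
qed

lemma u_count_zero_mod:
  assumes "\<delta> \<le> k" "[b = 0] (mod 3 ^ \<delta>)"
  shows "residue_count u (3 ^ k) b = 1"
proof -
  have b: "3 ^ \<delta> dvd b" using assms(2) by (simp add: cong_0_iff)
  then have "3 dvd b" by (rule three_power_dvd_imp_three_dvd)
  then have "\<not> 3 dvd b - 1" by presburger
  then show ?thesis using residue_count_u[OF assms(1)] b by simp
qed

text \<open>The exponent covers both ranges of \<open>k\<close>: it is \<open>k div 2\<close> when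
  half of \<open>k\<close>, rounded up, is at least \<open>\<delta>\<close>, and
  \<open>k - \<delta>\<close> when it is at most \<open>\<delta>\<close>.\<close>

lemma v_count_two:
  assumes "\<delta> \<le> k" "[b = 2] (mod 3 ^ k)"
  shows "residue_count v (3 ^ k) b = 3 ^ (k - max \<delta> ((k + 1) div 2))"
proof -
  have "3 dvd b - 2" using assms \<delta>_pos by (intro cong_three_power_imp_three_dvd[of b 2 k]) auto
  then have "\<not> 3 dvd b" by presburger
  then have "\<not> 3 ^ \<delta> dvd b" using three_power_dvd_imp_three_dvd by blast
  moreover have "3 ^ k dvd b - 2" using assms(2) by (simp add: cong_iff_dvd_diff)
  ultimately show ?thesis using residue_count_v[OF assms(1)] square_count_zero assms(1) by simp
qed

text \<open>Keeping \<open>j\<close> general lets this case serve both parts of the theorem, with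
  different powers of 3 as index.\<close>

lemma u_count_one:
  assumes "\<delta> \<le> k" "k \<le> 2 * (\<delta> + j)" "[b = u (3 ^ j)] (mod 3 ^ k)"
  shows "residue_count u (3 ^ k) b = 3 ^ (k - max \<delta> ((k + 1) div 2))"
proof -
  have "3 dvd b - u (3 ^ j)" using assms \<delta>_pos by (intro cong_three_power_imp_three_dvd[of b _ k]) auto
  then have b: "3 dvd b - 1" using u_odd[of "3 ^ j"] by simp presburger
  then have "\<not> 3 dvd b" by presburger
  then have "\<not> 3 ^ \<delta> dvd b" using three_power_dvd_imp_three_dvd by blast
  moreover have "3 ^ k dvd (P\<^sup>2 + 4) * b\<^sup>2 - 4"
    using u_zero_class_iff[OF assms(2) b] assms(3) by simp
  ultimately show ?thesis using residue_count_u[OF assms(1)] square_count_zero assms(1) b by simp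
qed

lemma v_count_class:
  assumes "l \<in> {\<delta>..(k - 1) div 2}" "[b = v (2 * 3 ^ (l - \<delta>))] (mod 3 ^ (2 * l + 1))"
  shows "residue_count v (3 ^ k) b = 2 * 3 ^ l"
proof -
  have l: "\<delta> \<le> l" "2 * l < k" "\<delta> \<le> k" using assms(1) \<delta>_pos by auto
  have "3 dvd b - v (2 * 3 ^ (l - \<delta>))" by (rule cong_three_power_imp_three_dvd[OF assms(2)]) simp
  then have "3 dvd b - 2" using v_even[of "2 * 3 ^ (l - \<delta>)"] by simp presburger
  then have "\<not> 3 dvd b" by presburger
  then have "\<not> 3 ^ \<delta> dvd b" using three_power_dvd_imp_three_dvd by blast
  moreover have "square_count \<delta> k (b - 2) = 2 * 3 ^ l"
    using v_class_iff[OF l(1)] assms(2) by (intro square_count_nonzero[OF l(1,2)]) blast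
  ultimately show ?thesis using residue_count_v[OF l(3)] by simp
qed

lemma u_count_class:
  assumes "l \<in> {\<delta>..(k - 1) div 2}" "[b = u (3 ^ (l - \<delta>))] (mod 3 ^ (2 * l + 1))"
  shows "residue_count u (3 ^ k) b = 2 * 3 ^ l"
proof -
  have l: "\<delta> \<le> l" "2 * l < k" "\<delta> \<le> k" using assms(1) \<delta>_pos by auto
  have "3 dvd b - u (3 ^ (l - \<delta>))" by (rule cong_three_power_imp_three_dvd[OF assms(2)]) simp
  then have b: "3 dvd b - 1" using u_odd[of "3 ^ (l - \<delta>)"] by simp presburger
  then have "\<not> 3 dvd b" by presburger
  then have "\<not> 3 ^ \<delta> dvd b" using three_power_dvd_imp_three_dvd by blast
  moreover have "square_count \<delta> k ((P\<^sup>2 + 4) * b\<^sup>2 - 4) = 2 * 3 ^ l"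
    using u_class_iff[OF l(1) b] assms(2) by (intro square_count_nonzero[OF l(1,2)]) blast
  ultimately show ?thesis using residue_count_u[OF l(3)] b by simp
qed

lemma v_count_other:
  assumes "\<delta> \<le> k" "\<not> [b = 2] (mod 3 ^ k)" "\<not> [b = 0] (mod 3 ^ \<delta>)"
    and "\<not> (\<exists>l\<in>{\<delta>..(k - 1) div 2}. [b = v (2 * 3 ^ (l - \<delta>))] (mod 3 ^ (2 * l + 1)))"
  shows "residue_count v (3 ^ k) b = 0"
proof -
  have "square_count \<delta> k (b - 2) = 0"
  proof (rule square_count_eq_0I)
    show "\<not> 3 ^ k dvd b - 2" using assms(2) by (simp add: cong_iff_dvd_diff)
    show "\<not> [b - 2 = 3 ^ (2 * l)] (mod 3 ^ (2 * l + 1))" if "l \<in> {\<delta>..(k - 1) div 2}" for l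
    proof -
      have "\<delta> \<le> l" using that by simp
      then show ?thesis using v_class_iff assms(4) that by blast
    qed
  qed
  then show ?thesis using residue_count_v[OF assms(1)] assms(3) by (simp add: cong_0_iff)
qed

lemma u_count_other:
  assumes "\<delta> \<le> k" "k \<le> 2 * (\<delta> + j)" "\<not> [b = u (3 ^ j)] (mod 3 ^ k)" "\<not> [b = 0] (mod 3 ^ \<delta>)"
    and "\<not> (\<exists>l\<in>{\<delta>..(k - 1) div 2}. [b = u (3 ^ (l - \<delta>))] (mod 3 ^ (2 * l + 1)))"
  shows "residue_count u (3 ^ k) b = 0"
proof -
  have "square_count \<delta> k ((P\<^sup>2 + 4) * b\<^sup>2 - 4) = 0" if b: "3 dvd b - 1"
  proof (rule square_count_eq_0I)
    show "\<not> 3 ^ k dvd (P\<^sup>2 + 4) * b\<^sup>2 - 4" using u_zero_class_iff[OF assms(2) b] assms(3) by blast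
    show "\<not> [(P\<^sup>2 + 4) * b\<^sup>2 - 4 = 3 ^ (2 * l)] (mod 3 ^ (2 * l + 1))" if "l \<in> {\<delta>..(k - 1) div 2}" for l
    proof -
      have "\<delta> \<le> l" using that by simp
      then show ?thesis using u_class_iff[OF _ b] assms(5) that by blast
    qed
  qed
  then show ?thesis using residue_count_u[OF assms(1)] assms(4) by (simp add: cong_0_iff)
qed

end

(* The index k - 2 * \<delta> + 1 is written k + 1 - 2 * \<delta>, since subtraction on nat truncates and
   k = 2 * \<delta> - 1 is allowed. *)
theorem theorem2:
  fixes P :: int and \<delta> :: nat
  assumes "3 dvd P" and "\<delta> \<ge> 1"
    and "3 ^ \<delta> dvd P" and "\<not> 3 ^ (\<delta> + 1) dvd P"
  shows
    "(\<forall>k::nat. k \<ge> 1 \<and> k \<ge> 2 * \<delta> - 1 \<longrightarrow> (\<forall>b::int.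
        (([b = lucas_u P (3 ^ (2 * ((k + 1 - 2 * \<delta>) div 4) + 1))] (mod 3 ^ k) \<longrightarrow>
            residue_count (lucas_u P) (3 ^ k) b = 3 ^ (k div 2)) \<and>
         (\<forall>l\<in>{\<delta>..(k - 1) div 2}. [b = lucas_u P (3 ^ (l - \<delta>))] (mod 3 ^ (2 * l + 1)) \<longrightarrow>
            residue_count (lucas_u P) (3 ^ k) b = 2 * 3 ^ l) \<and>
         ([b = 0] (mod 3 ^ \<delta>) \<longrightarrow>
            residue_count (lucas_u P) (3 ^ k) b = 1) \<and>
         (\<not> [b = lucas_u P (3 ^ (2 * ((k + 1 - 2 * \<delta>) div 4) + 1))] (mod 3 ^ k) \<and>
          \<not> (\<exists>l\<in>{\<delta>..(k - 1) div 2}. [b = lucas_u P (3 ^ (l - \<delta>))] (mod 3 ^ (2 * l + 1))) \<and>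
          \<not> [b = 0] (mod 3 ^ \<delta>) \<longrightarrow>
            residue_count (lucas_u P) (3 ^ k) b = 0)) \<and>
        (([b = 2] (mod 3 ^ k) \<longrightarrow>
            residue_count (lucas_v P) (3 ^ k) b = 3 ^ (k div 2)) \<and>
         (\<forall>l\<in>{\<delta>..(k - 1) div 2}. [b = lucas_v P (2 * 3 ^ (l - \<delta>))] (mod 3 ^ (2 * l + 1)) \<longrightarrow>
            residue_count (lucas_v P) (3 ^ k) b = 2 * 3 ^ l) \<and>
         ([b = 0] (mod 3 ^ \<delta>) \<longrightarrow>
            residue_count (lucas_v P) (3 ^ k) b = 1) \<and>
         (\<not> [b = 2] (mod 3 ^ k) \<and>
          \<not> (\<exists>l\<in>{\<delta>..(k - 1) div 2}. [b = lucas_v P (2 * 3 ^ (l - \<delta>))] (mod 3 ^ (2 * l + 1))) \<and>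
          \<not> [b = 0] (mod 3 ^ \<delta>) \<longrightarrow>
            residue_count (lucas_v P) (3 ^ k) b = 0)))) \<and>
     (\<delta> \<ge> 2 \<longrightarrow> (\<forall>k::nat. k \<ge> 1 \<and> \<delta> \<le> k \<and> k < 2 * \<delta> - 1 \<longrightarrow> (\<forall>b::int.
        (([b = 1] (mod 3 ^ k) \<longrightarrow>
            residue_count (lucas_u P) (3 ^ k) b = 3 ^ (k - \<delta>)) \<and>
         ([b = 0] (mod 3 ^ \<delta>) \<longrightarrow>
            residue_count (lucas_u P) (3 ^ k) b = 1) \<and>
         (\<not> [b = 1] (mod 3 ^ k) \<and> \<not> [b = 0] (mod 3 ^ \<delta>) \<longrightarrow>
            residue_count (lucas_u P) (3 ^ k) b = 0)) \<and>
        (([b = 2] (mod 3 ^ k) \<longrightarrow>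
            residue_count (lucas_v P) (3 ^ k) b = 3 ^ (k - \<delta>)) \<and>
         ([b = 0] (mod 3 ^ \<delta>) \<longrightarrow>
            residue_count (lucas_v P) (3 ^ k) b = 1) \<and>
         (\<not> [b = 2] (mod 3 ^ k) \<and> \<not> [b = 0] (mod 3 ^ \<delta>) \<longrightarrow>
            residue_count (lucas_v P) (3 ^ k) b = 0)))))"
proof -
  interpret lucas_three P \<delta> by unfold_locales (use assms in auto)
  show ?thesis
  proof (intro conjI allI impI ballI)
    fix k :: nat and b :: int
    assume k: "1 \<le> k \<and> 2 * \<delta> - 1 \<le> k"
    then have dk: "\<delta> \<le> k" using \<delta>_pos by linarith
    \<comment> \<open>Division by 4 loses at most 3 from \<open>k + 1 - 2 * \<delta>\<close>;
      doubling the final summand 1 gives back 2, which leaves exactly \<open>k\<close>.\<close>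
    have kj: "k \<le> 2 * (\<delta> + (2 * ((k + 1 - 2 * \<delta>) div 4) + 1))" using k by presburger
    \<comment> \<open>Here \<open>2 * \<delta> - 1 \<le> k\<close> gives
      \<open>\<delta> \<le> (k + 1) div 2\<close>, so the second argument is the maximum.\<close>
    have ex: "k - max \<delta> ((k + 1) div 2) = k div 2" using k by linarith
    show "residue_count u (3 ^ k) b = 3 ^ (k div 2)"
      if "[b = u (3 ^ (2 * ((k + 1 - 2 * \<delta>) div 4) + 1))] (mod 3 ^ k)"
      using u_count_one[OF dk kj that] unfolding ex .
    show "residue_count v (3 ^ k) b = 3 ^ (k div 2)" if "[b = 2] (mod 3 ^ k)"
      using v_count_two[OF dk that] unfolding ex .
    show "residue_count u (3 ^ k) b = 2 * 3 ^ l"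
      if "l \<in> {\<delta>..(k - 1) div 2}" "[b = u (3 ^ (l - \<delta>))] (mod 3 ^ (2 * l + 1))" for l
      using that by (rule u_count_class)
    show "residue_count v (3 ^ k) b = 2 * 3 ^ l"
      if "l \<in> {\<delta>..(k - 1) div 2}" "[b = v (2 * 3 ^ (l - \<delta>))] (mod 3 ^ (2 * l + 1))" for l
      using that by (rule v_count_class)
    show "residue_count u (3 ^ k) b = 1" "residue_count v (3 ^ k) b = 1" if "[b = 0] (mod 3 ^ \<delta>)"
      using dk that by (rule u_count_zero_mod v_count_zero_mod)+
    show "residue_count u (3 ^ k) b = 0"
      if "\<not> [b = u (3 ^ (2 * ((k + 1 - 2 * \<delta>) div 4) + 1))] (mod 3 ^ k) \<and>
        \<not> (\<exists>l\<in>{\<delta>..(k - 1) div 2}. [b = u (3 ^ (l - \<delta>))] (mod 3 ^ (2 * l + 1))) \<and>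
        \<not> [b = 0] (mod 3 ^ \<delta>)"
      using u_count_other[OF dk kj] that by blast
    show "residue_count v (3 ^ k) b = 0"
      if "\<not> [b = 2] (mod 3 ^ k) \<and>
        \<not> (\<exists>l\<in>{\<delta>..(k - 1) div 2}. [b = v (2 * 3 ^ (l - \<delta>))] (mod 3 ^ (2 * l + 1))) \<and>
        \<not> [b = 0] (mod 3 ^ \<delta>)"
      using v_count_other[OF dk] that by blast
  next
    fix k :: nat and b :: int
    assume k: "1 \<le> k \<and> \<delta> \<le> k \<and> k < 2 * \<delta> - 1"
    \<comment> \<open>For small \<open>k\<close> the choice \<open>j = 0\<close> suffices, turning
      the class of \<open>u (3 ^ j)\<close> into that of 1; the maximum is \<open>\<delta>\<close>,
      and no intermediate class exists.\<close>
    then have dk: "\<delta> \<le> k" and kj: "k \<le> 2 * (\<delta> + 0)"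
      and ex: "k - max \<delta> ((k + 1) div 2) = k - \<delta>" and empty: "{\<delta>..(k - 1) div 2} = {}" by auto
    show "residue_count u (3 ^ k) b = 3 ^ (k - \<delta>)" if "[b = 1] (mod 3 ^ k)"
      using u_count_one[OF dk kj] that unfolding ex by simp
    show "residue_count v (3 ^ k) b = 3 ^ (k - \<delta>)" if "[b = 2] (mod 3 ^ k)"
      using v_count_two[OF dk that] unfolding ex .
    show "residue_count u (3 ^ k) b = 1" "residue_count v (3 ^ k) b = 1" if "[b = 0] (mod 3 ^ \<delta>)"
      using dk that by (rule u_count_zero_mod v_count_zero_mod)+
    show "residue_count u (3 ^ k) b = 0" if "\<not> [b = 1] (mod 3 ^ k) \<and> \<not> [b = 0] (mod 3 ^ \<delta>)"
      using u_count_other[OF dk kj] that empty by simp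
    show "residue_count v (3 ^ k) b = 0" if "\<not> [b = 2] (mod 3 ^ k) \<and> \<not> [b = 0] (mod 3 ^ \<delta>)"
      using v_count_other[OF dk] that empty by simp
  qed
qed

end
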